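(* Let $\Lambda\leq\omega_2$ be a limit ordinal and let $\mathfrak F=(\phi_\eta)_{\eta<\Lambda}$ be a sequence of normal functions of first class satisfying properties (1)–(4) described in the context. Then $\Lambda$ is of the third kind, i.e. $\Lambda$ has cofinality $\Omega$ (it is the supremum of a strictly increasing sequence of length $\Omega$).
   Context: $\Omega=\omega_1$, $\omega_2$ is the second uncountable initial ordinal. A normal function of first class is a strictly increasing function $\phi$ from $\{x:1\leq x<\Omega\}$ to itself which is continuous: $\phi(x)=\sup_{1\leq x'<x}\phi(x')$ for limit $x<\Omega$. $V\phi$ is its range; the derivative $\phi'$ is the normal function of first class enumerating increasingly the fixed points of $\phi$. A limit ordinal $\eta<\omega_2$ is "of the second kind" if it has cofinality $\omega$ and "of the third kind" if it has cofinality $\Omega$. For ordinals $\alpha<\beta<\Lambda$, write $\alpha\to\beta$ if $V\phi_\zeta\subseteq V\phi_\alpha$ for all $\zeta$ with $\alpha<\zeta\leq\beta$. Properties of $\mathfrak F$ (for all $\eta<\Lambda$): (1a) $\phi_0(x)=\omega^x$. (1b) If $\eta=\eta'+1$ then $\phi_\eta=\phi'_{\eta'}$. (1c) If $\eta$ is of the second kind, $\eta$ is assigned a countable limit ordinal $\tau_\eta$ and a strictly increasing sequence $(\eta_x)_{x<\tau_\eta}$ with supremum $\eta$, and $V\phi_\eta=\bigcap_{x<\tau_\eta}V\phi_{\eta_x}$. (1d) If $\eta$ is of the third kind, $\eta$ is assigned a strictly increasing sequence $(\eta_x)_{x<\Omega}$ with supremum $\eta$ (set $\tau_\eta=\Omega$),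 and $\phi_\eta(x)=\phi_{\eta_x}(1)$ for $1\leq x<\Omega$. (2) For every limit $\eta<\Lambda$ with assigned sequence $(\eta_x)_{x<\tau_\eta}$ and all $x$ with $1\leq x<\tau_\eta$: (a) if $x$ is a limit ordinal, then the sequence assigned to $\eta_x$ is $(\eta_{x'})_{x'<x}$; (b) $\eta_x+1\to\eta_{x+1}$. (3) If $\eta<\Lambda$ is of the second kind and $\phi_\eta(1)=\tau_\eta$, then there is an ordinal $\tilde\eta$ of the third kind with $\eta<\tilde\eta<\Lambda$ whose assigned sequence $(\tilde\eta_x)_{x<\Omega}$ satisfies $\tilde\eta_x=\eta_x$ for $x<\tau_\eta$ and $\tilde\eta_{\tau_\eta}=\eta$. (4) If $(\eta_\nu)_{\nu<\lambda}$ is a sequence of ordinals $<\Lambda$ whose length $\lambda$ is a limit ordinal and with $\sup_{\nu<\lambda}\eta_\nu=\Lambda$, then $\bigcap_{\nu<\lambda}V\phi_{\eta_\nu}=\emptyset$. *)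

theory Defs
  imports Main "HOL-Library.Countable_Set" "HOL-Library.Equipollence"
begin

unbundle cardinal_syntax

text \<open>
  The ordinals are represented by a well-ordered type of order type \<open>\<omega>\<^sub>3\<close>. It contains
  \<open>\<omega>\<^sub>2\<close> as an element, every subset of size at most \<open>\<aleph>\<^sub>2\<close> is bounded in it, and it is closed
  under ordinal arithmetic.
\<close>

abbreviation ord_rel :: "nat set set set rel"
  where "ord_rel \<equiv> cardSuc (cardSuc (cardSuc natLeq))"

lemma Card_order_ord_rel: "Card_order ord_rel"
  by (intro cardSuc_Card_order natLeq_Card_order)

lemma Well_order_ord_rel: "Well_order ord_rel"
  using Card_order_ord_rel card_order_on_well_order_on by blast

lemma infinite_cardSuc_natLeq: "infinite (Field (cardSuc natLeq))"
  using cardSuc_finite[OF natLeq_Card_order] by (metis Field_natLeq infinite_UNIV_nat)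

lemma infinite_cardSuc_cardSuc_natLeq: "infinite (Field (cardSuc (cardSuc natLeq)))"
  using cardSuc_finite[OF cardSuc_Card_order[OF natLeq_Card_order]] infinite_cardSuc_natLeq by blast

lemma infinite_ord_rel: "infinite (Field ord_rel)"
  using cardSuc_finite[OF cardSuc_Card_order[OF cardSuc_Card_order[OF natLeq_Card_order]]]
    infinite_cardSuc_cardSuc_natLeq by blast

typedef ordinal = "Field ord_rel"
proof -
  have "Field ord_rel \<noteq> {}" using infinite_ord_rel by force
  then show "\<exists>x. x \<in> Field ord_rel" by blast
qed

instantiation ordinal :: wellorder
begin

definition less_eq_ordinal :: "ordinal \<Rightarrow> ordinal \<Rightarrow> bool"
  where "x \<le> y \<longleftrightarrow> (Rep_ordinal x, Rep_ordinal y) \<in> ord_rel"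

definition less_ordinal :: "ordinal \<Rightarrow> ordinal \<Rightarrow> bool"
  where "(x::ordinal) < y \<longleftrightarrow> x \<le> y \<and> x \<noteq> y"

instance
proof
  have po: "refl_on (Field ord_rel) ord_rel" "trans ord_rel" "antisym ord_rel"
    "total_on (Field ord_rel) ord_rel"
    using Well_order_ord_rel
    unfolding well_order_on_def linear_order_on_def partial_order_on_def preorder_on_def
    by simp_all
  fix x y z :: ordinal
  show refl: "x \<le> x"
    unfolding less_eq_ordinal_def by (rule refl_onD[OF po(1) Rep_ordinal])
  show "x \<le> y \<Longrightarrow> y \<le> z \<Longrightarrow> x \<le> z"
    unfolding less_eq_ordinal_def by (rule transD[OF po(2)])
  have antisym: "x = y" if "x \<le> y" "y \<le> x"
    using antisymD[OF po(3) that[unfolded less_eq_ordinal_def]] by (simp add: Rep_ordinal_inject)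
  then show "x \<le> y \<Longrightarrow> y \<le> x \<Longrightarrow> x = y" .
  show "x < y \<longleftrightarrow> x \<le> y \<and> \<not> y \<le> x"
    unfolding less_ordinal_def using antisym refl by auto
  show "x \<le> y \<or> y \<le> x"
  proof (cases "x = y")
    case False
    then have "Rep_ordinal x \<noteq> Rep_ordinal y" by (simp add: Rep_ordinal_inject)
    then show ?thesis
      using po(4) Rep_ordinal[of x] Rep_ordinal[of y]
      unfolding less_eq_ordinal_def total_on_def by simp
  qed (use refl in simp)
next
  fix P :: "ordinal \<Rightarrow> bool" and a :: ordinal
  assume step: "\<And>x. (\<And>y. y < x \<Longrightarrow> P y) \<Longrightarrow> P x"
  have "wf (ord_rel - Id)"
    using Well_order_ord_rel unfolding well_order_on_def by simp
  then have "wf (inv_image (ord_rel - Id) Rep_ordinal)" by (rule wf_inv_image)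
  then show "P a"
  proof (induction a)
    case (less x)
    show ?case
      by (rule step, rule less.IH)
         (auto simp: inv_image_def less_ordinal_def less_eq_ordinal_def Rep_ordinal_inject)
  qed
qed

end

lemma image_Rep_lessThan: "Rep_ordinal ` {..<x} = underS ord_rel (Rep_ordinal x)"
proof -
  have "b \<in> Rep_ordinal ` {..<x}" if "b \<noteq> Rep_ordinal x" "(b, Rep_ordinal x) \<in> ord_rel" for b
  proof -
    have "b \<in> Field ord_rel" using that by (auto simp: Field_def)
    then obtain c where "b = Rep_ordinal c" using Rep_ordinal_cases by metis
    then show ?thesis using that by (auto simp: less_ordinal_def less_eq_ordinal_def)
  qed
  then show ?thesis
    by (auto simp: underS_def less_ordinal_def less_eq_ordinal_def Rep_ordinal_inject)
qed

lemma card_of_image_Rep: "|Rep_ordinal ` A| =o |A|"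
proof -
  have "bij_betw Rep_ordinal A (Rep_ordinal ` A)"
    using Rep_ordinal_inject by (auto simp: bij_betw_def inj_on_def)
  then show ?thesis using card_of_ordIsoI ordIso_symmetric by blast
qed

lemma card_of_lessThan_ordinal: "|{..<x::ordinal}| <o ord_rel"
proof -
  have "|underS ord_rel (Rep_ordinal x)| <o ord_rel"
    by (rule card_of_underS[OF Card_order_ord_rel Rep_ordinal])
  then show ?thesis
    using card_of_image_Rep[of "{..<x}"] ordIso_ordLess_trans ordIso_symmetric
    unfolding image_Rep_lessThan by blast
qed

lemma bounded_small:
  fixes A :: "ordinal set"
  assumes "|A| <o ord_rel"
  obtains u where "\<And>a. a \<in> A \<Longrightarrow> a < u"
proof -
  have reg: "regularCard ord_rel"
    by (rule infinite_cardSuc_regularCard[OF infinite_cardSuc_cardSuc_natLeq])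
       (intro cardSuc_Card_order natLeq_Card_order)
  have small: "|Rep_ordinal ` A| <o ord_rel"
    using card_of_image_Rep[of A] assms ordIso_ordLess_trans by blast
  then have "\<not> |Rep_ordinal ` A| =o ord_rel" using not_ordLess_ordIso by blast
  then have "\<not> cofinal (Rep_ordinal ` A) ord_rel"
    using reg Rep_ordinal unfolding regularCard_def by blast
  then obtain v where v: "v \<in> Field ord_rel"
    "\<forall>b\<in>Rep_ordinal ` A. \<not> (v \<noteq> b \<and> (v, b) \<in> ord_rel)"
    unfolding cofinal_def by blast
  obtain u where u: "v = Rep_ordinal u" using v(1) Rep_ordinal_cases by metis
  have le: "a \<le> u" if "a \<in> A" for a
  proof -
    have "\<not> u < a" using v(2) that by (auto simp: u less_ordinal_def less_eq_ordinal_def Rep_ordinal_inject)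
    then show ?thesis by simp
  qed
  obtain w where w: "w \<in> Field ord_rel" "v \<noteq> w" "(v, w) \<in> ord_rel"
    using infinite_Card_order_limit[OF Card_order_ord_rel infinite_ord_rel v(1)] by blast
  obtain t where t: "w = Rep_ordinal t" using w(1) Rep_ordinal_cases by metis
  have "u < t" using w u t by (auto simp: less_ordinal_def less_eq_ordinal_def)
  then show ?thesis using le that[of t] by fastforce
qed

lemma bounded_image:
  fixes f :: "ordinal \<Rightarrow> ordinal"
  obtains u where "\<And>y. y < x \<Longrightarrow> f y < u"
proof -
  have "|f ` {..<x}| <o ord_rel"
    using card_of_image card_of_lessThan_ordinal ordLeq_ordLess_trans by blast
  from bounded_small[OF this] obtain u where "\<And>a. a \<in> f ` {..<x} \<Longrightarrow> a < u" by blast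
  then show ?thesis using that by blast
qed

lemma ex_greater: "\<exists>u::ordinal. x < u"
proof -
  have "finite {x}" by simp
  then have "|{x}| <o ord_rel"
    using infinite_ord_rel finite_ordLess_infinite[of "|{x}|" ord_rel] Well_order_ord_rel
      card_of_Well_order[of "{x}"]
    by (simp only: Field_card_of simp_thms)
  from bounded_small[OF this] show ?thesis by blast
qed

instantiation ordinal :: conditionally_complete_linorder
begin

definition inf_ordinal :: "ordinal \<Rightarrow> ordinal \<Rightarrow> ordinal" where "inf_ordinal = min"
definition sup_ordinal :: "ordinal \<Rightarrow> ordinal \<Rightarrow> ordinal" where "sup_ordinal = max"
definition Inf_ordinal :: "ordinal set \<Rightarrow> ordinal" where "Inf (A::ordinal set) = (LEAST x. x \<in> A)"
definition Sup_ordinal :: "ordinal set \<Rightarrow> ordinal" where "Sup (A::ordinal set) = (LEAST u. \<forall>x\<in>A. x \<le> u)"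

instance
proof
  fix X :: "ordinal set" and x y z :: ordinal
  show "x \<in> X \<Longrightarrow> Inf X \<le> x" unfolding Inf_ordinal_def by (rule Least_le)
  show "X \<noteq> {} \<Longrightarrow> (\<And>x. x \<in> X \<Longrightarrow> z \<le> x) \<Longrightarrow> z \<le> Inf X"
    unfolding Inf_ordinal_def by (metis LeastI ex_in_conv)
  show "x \<le> Sup X" if "x \<in> X" "bdd_above X"
  proof -
    have "\<exists>u. \<forall>x\<in>X. x \<le> u" using that(2) unfolding bdd_above_def by blast
    then have "\<forall>x\<in>X. x \<le> Sup X" unfolding Sup_ordinal_def by (rule LeastI_ex)
    then show ?thesis using that(1) by blast
  qed
  show "(\<And>x. x \<in> X \<Longrightarrow> x \<le> z) \<Longrightarrow> Sup X \<le> z"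
    unfolding Sup_ordinal_def by (blast intro: Least_le)
qed (auto simp: inf_ordinal_def sup_ordinal_def)

end

instantiation ordinal :: zero_neq_one
begin

definition zero_ordinal :: ordinal where "0 = (LEAST x::ordinal. True)"
definition one_ordinal :: ordinal where "1 = (LEAST x::ordinal. 0 < x)"

instance
proof
  have "(0::ordinal) < 1"
    unfolding one_ordinal_def using ex_greater by (rule LeastI_ex)
  then show "(0::ordinal) \<noteq> 1" by simp
qed

end

lemma ordinal_zero_le [simp]: "(0::ordinal) \<le> x"
  unfolding zero_ordinal_def by (rule Least_le) simp

text \<open>
  The arithmetic operations are given by uniform recursions; the usual clauses for zero,
  successors and limits are derived below.
\<close>

instantiation ordinal :: plus
begin

function plus_ordinal :: "ordinal \<Rightarrow> ordinal \<Rightarrow> ordinal" where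
  "plus_ordinal a b = (LEAST c. a \<le> c \<and> (\<forall>d. d < b \<longrightarrow> plus_ordinal a d < c))"
  by auto
termination
  by (relation "inv_image {(x, y). x < y} snd") (auto intro: wf)

instance ..

end

declare plus_ordinal.simps [simp del]

instantiation ordinal :: times
begin

function times_ordinal :: "ordinal \<Rightarrow> ordinal \<Rightarrow> ordinal" where
  "times_ordinal a b = (LEAST c. \<forall>d. d < b \<longrightarrow> times_ordinal a d + a \<le> c)"
  by auto
termination
  by (relation "inv_image {(x, y). x < y} snd") (auto intro: wf)

instance ..

end

declare times_ordinal.simps [simp del]

definition is_limit :: "ordinal \<Rightarrow> bool"
  where "is_limit x \<longleftrightarrow> x \<noteq> 0 \<and> (\<nexists>y. x = y + 1)"

definition omega :: ordinal where "omega = (LEAST x. is_limit x)"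

function omega_pow :: "ordinal \<Rightarrow> ordinal" where
  "omega_pow x = (LEAST c. 1 \<le> c \<and> (\<forall>y. y < x \<longrightarrow> omega_pow y * omega \<le> c))"
  by auto
termination
  by (relation "{(x, y). x < y}") (auto intro: wf)

declare omega_pow.simps [simp del]

definition omega1 :: ordinal (\<open>\<Omega>\<close>)
  where "\<Omega> = (LEAST x. uncountable {..<x})"

definition omega2 :: ordinal (\<open>\<omega>\<^sub>2\<close>)
  where "\<omega>\<^sub>2 = (LEAST x. {..<\<Omega>} \<prec> {..<x})"

definition cofinality :: "ordinal \<Rightarrow> ordinal"
  where "cofinality x =
    (LEAST k. \<exists>f. (\<forall>i<k. f i < x) \<and> (\<forall>y<x. \<exists>i<k. y \<le> f i))"

lemma plus_ordinal_char:
  fixes a b :: ordinal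
  shows "a \<le> a + b" "d < b \<Longrightarrow> a + d < a + b"
    and "a \<le> c \<Longrightarrow> (\<And>d. d < b \<Longrightarrow> a + d < c) \<Longrightarrow> a + b \<le> c"
proof -
  obtain u where u: "\<And>d. d < b \<Longrightarrow> a + d < u" using bounded_image[of b "\<lambda>d. a + d"] by blast
  have "a \<le> max a u \<and> (\<forall>d. d < b \<longrightarrow> a + d < max a u)"
    using u by (auto simp: less_max_iff_disj)
  then have *: "a \<le> a + b \<and> (\<forall>d. d < b \<longrightarrow> a + d < a + b)"
    by (subst (1 3) plus_ordinal.simps) (rule LeastI)
  show "a \<le> a + b" "d < b \<Longrightarrow> a + d < a + b" using * by auto
  show "a \<le> c \<Longrightarrow> (\<And>d. d < b \<Longrightarrow> a + d < c) \<Longrightarrow> a + b \<le> c"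
    by (subst plus_ordinal.simps) (auto intro: Least_le)
qed

lemma ordinal_not_less_zero [simp]: "\<not> x < (0::ordinal)"
  by (simp add: not_less)

lemma ordinal_zero_less_one [simp]: "(0::ordinal) < 1"
  using ordinal_zero_le[of 1] zero_neq_one by (simp add: order.strict_iff_order del: ordinal_zero_le)

lemma ordinal_less_one_iff [simp]: "x < (1::ordinal) \<longleftrightarrow> x = 0"
proof
  assume "x < 1"
  then have "\<not> 0 < x" unfolding one_ordinal_def by (rule not_less_Least)
  then show "x = 0" using ordinal_zero_le[of x] by (simp add: not_less order.antisym)
qed simp

lemma plus_ordinal_zero [simp]: "a + 0 = (a::ordinal)"
  by (rule order.antisym) (auto intro: plus_ordinal_char)

lemma less_plus_one [simp]: "a < a + (1::ordinal)"
  using plus_ordinal_char(2)[of 0 1 a] by simp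

lemma plus_one_le_iff: "a + 1 \<le> c \<longleftrightarrow> a < (c::ordinal)"
proof
  show "a + 1 \<le> c \<Longrightarrow> a < c" by (rule order.strict_trans2[OF less_plus_one])
  show "a < c \<Longrightarrow> a + 1 \<le> c" by (rule plus_ordinal_char(3)) simp_all
qed

lemma less_plus_one_iff: "a < b + 1 \<longleftrightarrow> a \<le> (b::ordinal)"
  using plus_one_le_iff[of b a] by (simp add: not_le[symmetric])

lemma plus_ordinal_succ: "a + (b + 1) = (a + b) + (1::ordinal)"
proof (rule order.antisym)
  show "a + (b + 1) \<le> (a + b) + 1"
  proof (rule plus_ordinal_char(3))
    show "a \<le> a + b + 1"
      by (rule order.trans[OF plus_ordinal_char(1) less_imp_le[OF less_plus_one]])
    show "a + d < a + b + 1" if "d < b + 1" for d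
      using that plus_ordinal_char(2)[of d b a] by (auto simp: less_plus_one_iff order.order_iff_strict)
  qed
  show "a + b + 1 \<le> a + (b + 1)" by (simp add: plus_one_le_iff plus_ordinal_char(2))
qed

lemma limit_succ_less: "is_limit x \<Longrightarrow> y < x \<Longrightarrow> y + 1 < x"
  unfolding is_limit_def using plus_one_le_iff[of y x] by (auto simp: order.order_iff_strict)

lemma limit_pos: "is_limit x \<Longrightarrow> 0 < x"
  unfolding is_limit_def using ordinal_zero_le[of x] by (metis order.not_eq_order_implies_strict)

lemma bdd_above_image: "bdd_above ((f :: ordinal \<Rightarrow> ordinal) ` {..<x})"
proof -
  obtain u where "\<And>y. y < x \<Longrightarrow> f y < u" using bounded_image[of x f] by blast
  then show ?thesis by (intro bdd_aboveI[of _ u]) (auto intro: less_imp_le)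
qed

lemma plus_ordinal_limit:
  assumes "is_limit b"
  shows "a + b = (SUP d\<in>{..<b}. a + d)"
proof (rule order.antisym)
  have ub: "a + d \<le> (SUP d\<in>{..<b}. a + d)" if "d < b" for d
    using that by (intro cSUP_upper bdd_above_image) auto
  show "a + b \<le> (SUP d\<in>{..<b}. a + d)"
  proof (rule plus_ordinal_char(3))
    show "a \<le> (SUP d\<in>{..<b}. a + d)" using ub[of 0] limit_pos[OF assms] by simp
    show "a + d < (SUP d\<in>{..<b}. a + d)" if "d < b" for d
      using ub[OF limit_succ_less[OF assms that]] plus_ordinal_char(2)[of d "d + 1" a] by simp
  qed
  show "(SUP d\<in>{..<b}. a + d) \<le> a + b"
    using limit_pos[OF assms] by (intro cSUP_least) (auto intro: less_imp_le plus_ordinal_char)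
qed

lemma plus_ordinal_left_mono:
  assumes "a \<le> b"
  shows "a + c \<le> b + (c::ordinal)"
proof (induction c rule: less_induct)
  case (less c)
  show ?case
  proof (rule plus_ordinal_char(3))
    show "a \<le> b + c" using assms plus_ordinal_char(1)[of b c] by simp
    show "a + d < b + c" if "d < c" for d
      using less[OF that] plus_ordinal_char(2)[OF that, of b] by simp
  qed
qed

lemma times_ordinal_char:
  fixes a b :: ordinal
  shows "d < b \<Longrightarrow> a * d + a \<le> a * b"
    and "(\<And>d. d < b \<Longrightarrow> a * d + a \<le> c) \<Longrightarrow> a * b \<le> c"
proof -
  obtain u where "\<And>d. d < b \<Longrightarrow> a * d + a < u"
    using bounded_image[of b "\<lambda>d. a * d + a"] by blast
  then have "\<forall>d. d < b \<longrightarrow> a * d + a \<le> u" by (auto intro: less_imp_le)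
  then have "\<forall>d. d < b \<longrightarrow> a * d + a \<le> a * b"
    by (subst (2) times_ordinal.simps) (rule LeastI)
  then show "d < b \<Longrightarrow> a * d + a \<le> a * b" by blast
  show "(\<And>d. d < b \<Longrightarrow> a * d + a \<le> c) \<Longrightarrow> a * b \<le> c"
    by (subst times_ordinal.simps) (auto intro: Least_le)
qed

lemma times_ordinal_right_mono:
  assumes "b \<le> c" shows "a * b \<le> a * (c::ordinal)"
  using assms times_ordinal_char(1)[of b c a] plus_ordinal_char(1)[of "a * b" a]
  by (cases "b = c") (auto intro: order.trans)

lemma times_ordinal_zero: "a * 0 = (0::ordinal)"
  by (rule order.antisym) (auto intro: times_ordinal_char)

lemma times_ordinal_succ: "a * (b + 1) = a * b + (a::ordinal)"
proof (rule order.antisym)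
  show "a * (b + 1) \<le> a * b + a"
    by (rule times_ordinal_char(2), rule plus_ordinal_left_mono, rule times_ordinal_right_mono)
       (simp add: less_plus_one_iff)
  show "a * b + a \<le> a * (b + 1)" by (simp add: times_ordinal_char(1))
qed

lemma times_ordinal_limit:
  assumes "is_limit b"
  shows "a * b = (SUP d\<in>{..<b}. a * d)"
proof (rule order.antisym)
  show "a * b \<le> (SUP d\<in>{..<b}. a * d)"
  proof (rule times_ordinal_char(2))
    fix d assume "d < b"
    then have "d + 1 \<in> {..<b}" using limit_succ_less[OF assms] by simp
    then have "a * (d + 1) \<le> (SUP d\<in>{..<b}. a * d)" by (intro cSUP_upper bdd_above_image)
    then show "a * d + a \<le> (SUP d\<in>{..<b}. a * d)" by (simp add: times_ordinal_succ)
  qed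
  show "(SUP d\<in>{..<b}. a * d) \<le> a * b"
    using limit_pos[OF assms] by (intro cSUP_least) (auto intro: less_imp_le times_ordinal_right_mono)
qed

lemma times_ordinal_left_mono:
  assumes "a \<le> b"
  shows "a * c \<le> b * (c::ordinal)"
proof (induction c rule: less_induct)
  case (less c)
  show ?case
  proof (rule times_ordinal_char(2))
    fix d assume d: "d < c"
    have "a * d + a \<le> b * d + a" by (rule plus_ordinal_left_mono[OF less[OF d]])
    also have "\<dots> \<le> b * d + b"
      using assms plus_ordinal_char(2)[of a b "b * d"] by (cases "a = b") (auto intro: less_imp_le)
    also have "\<dots> \<le> b * c" by (rule times_ordinal_char(1)[OF d])
    finally show "a * d + a \<le> b * c" .
  qed
qed

lemma omega_pow_char:
  shows "1 \<le> omega_pow x" "y < x \<Longrightarrow> omega_pow y * omega \<le> omega_pow x"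
    and "1 \<le> c \<Longrightarrow> (\<And>y. y < x \<Longrightarrow> omega_pow y * omega \<le> c) \<Longrightarrow> omega_pow x \<le> c"
proof -
  obtain u where "\<And>y. y < x \<Longrightarrow> omega_pow y * omega < u"
    using bounded_image[of x "\<lambda>y. omega_pow y * omega"] by blast
  then have "1 \<le> max 1 u \<and> (\<forall>y. y < x \<longrightarrow> omega_pow y * omega \<le> max 1 u)"
    by (auto intro: less_imp_le simp: le_max_iff_disj)
  then have *: "1 \<le> omega_pow x \<and> (\<forall>y. y < x \<longrightarrow> omega_pow y * omega \<le> omega_pow x)"
    by (subst (1 3) omega_pow.simps) (rule LeastI)
  show "1 \<le> omega_pow x" "y < x \<Longrightarrow> omega_pow y * omega \<le> omega_pow x" using * by auto
  show "1 \<le> c \<Longrightarrow> (\<And>y. y < x \<Longrightarrow> omega_pow y * omega \<le> c) \<Longrightarrow> omega_pow x \<le> c"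
    by (subst omega_pow.simps) (auto intro: Least_le)
qed

lemma omega_pow_mono: "x \<le> y \<Longrightarrow> omega_pow x \<le> omega_pow y"
  by (rule omega_pow_char(3)) (auto intro: omega_pow_char order.strict_trans2)

lemma omega_pow_zero: "omega_pow 0 = 1"
  by (rule order.antisym) (auto intro: omega_pow_char)

lemma ex_limit: "\<exists>x. is_limit x"
proof -
  define A where "A = range (\<lambda>n. ((\<lambda>x. x + 1) ^^ n) (0::ordinal))"
  have "|A| \<le>o |UNIV :: nat set|" unfolding A_def by (rule card_of_image)
  also have "|UNIV :: nat set| =o natLeq" by (rule card_of_nat)
  also have "natLeq <o cardSuc natLeq" by (rule cardSuc_greater[OF natLeq_Card_order])
  also have "cardSuc natLeq <o cardSuc (cardSuc natLeq)"
    by (intro cardSuc_greater cardSuc_Card_order natLeq_Card_order)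
  also have "cardSuc (cardSuc natLeq) <o ord_rel"
    by (intro cardSuc_greater cardSuc_Card_order natLeq_Card_order)
  finally obtain u where u: "\<And>a. a \<in> A \<Longrightarrow> a < u" using bounded_small[of A] by blast
  define m where "m = (LEAST u. \<forall>a\<in>A. a < u)"
  have m: "\<forall>a\<in>A. a < m" unfolding m_def by (rule LeastI[of _ u]) (use u in blast)
  have zero: "0 \<in> A" unfolding A_def by (rule range_eqI[of _ _ 0]) simp
  have suc: "a + 1 \<in> A" if "a \<in> A" for a
  proof -
    from that obtain n where "a = ((\<lambda>x. x + 1) ^^ n) 0" unfolding A_def by blast
    then show ?thesis unfolding A_def by (intro range_eqI[of _ _ "Suc n"]) simp
  qed
  have "is_limit m"
    unfolding is_limit_def
  proof (intro conjI notI)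
    show False if "m = 0" using that m zero by fastforce
    show False if ex: "\<exists>y. m = y + 1"
    proof -
      from ex obtain y where y: "m = y + 1" by blast
      have "a < y" if "a \<in> A" for a
        using m suc[OF that] y less_plus_one[of a] by (metis less_plus_one_iff order.strict_trans2)
      then have "m \<le> y" unfolding m_def by (intro Least_le) blast
      then show False by (simp add: y plus_one_le_iff)
    qed
  qed
  then show ?thesis ..
qed

lemma is_limit_omega: "is_limit omega"
  unfolding omega_def using ex_limit by (rule LeastI_ex)

lemma omega_pow_succ: "omega_pow (x + 1) = omega_pow x * omega"
proof (rule order.antisym)
  have "omega_pow x * 1 \<le> omega_pow x * omega"
    using limit_pos[OF is_limit_omega]
    by (intro times_ordinal_right_mono) (simp add: not_less[symmetric] del: not_less)
  moreover have "omega_pow x \<le> omega_pow x * 1"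
  proof -
    have "a \<le> 0 + a" for a :: ordinal
    proof (induction a rule: less_induct)
      case (less a)
      show ?case
      proof (rule ccontr)
        assume "\<not> a \<le> 0 + a"
        then have "0 + a < a" by simp
        then have "0 + a \<le> 0 + (0 + a)" "0 + (0 + a) < 0 + a"
          using less plus_ordinal_char(2) by blast+
        then show False by simp
      qed
    qed
    moreover have "omega_pow x * 0 + omega_pow x \<le> omega_pow x * 1"
      by (rule times_ordinal_char(1)) simp
    ultimately show ?thesis by (metis times_ordinal_zero order.trans)
  qed
  ultimately have "1 \<le> omega_pow x * omega" using omega_pow_char(1)[of x] by (blast intro: order.trans)
  then show "omega_pow (x + 1) \<le> omega_pow x * omega"
    by (rule omega_pow_char(3)) (simp add: less_plus_one_iff omega_pow_mono times_ordinal_left_mono)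
  show "omega_pow x * omega \<le> omega_pow (x + 1)" by (simp add: omega_pow_char(2))
qed

lemma omega_pow_limit:
  assumes "is_limit x"
  shows "omega_pow x = (SUP y\<in>{..<x}. omega_pow y)"
proof (rule order.antisym)
  have ub: "omega_pow y \<le> (SUP y\<in>{..<x}. omega_pow y)" if "y < x" for y
    using that by (intro cSUP_upper bdd_above_image) auto
  show "omega_pow x \<le> (SUP y\<in>{..<x}. omega_pow y)"
  proof (rule omega_pow_char(3))
    show "1 \<le> (SUP y\<in>{..<x}. omega_pow y)"
      using ub[OF limit_pos[OF assms]] by (simp add: omega_pow_zero)
    show "omega_pow y * omega \<le> (SUP y\<in>{..<x}. omega_pow y)" if "y < x" for y
      using ub[OF limit_succ_less[OF assms that]] by (simp add: omega_pow_succ)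
  qed
  show "(SUP y\<in>{..<x}. omega_pow y) \<le> omega_pow x"
    using limit_pos[OF assms] by (intro cSUP_least) (auto intro: less_imp_le omega_pow_mono)
qed

lemma ex_lessThan_card:
  fixes r :: "'a rel"
  assumes "Card_order r" "r <o ord_rel"
  obtains x :: ordinal where "|{..<x}| =o r"
proof -
  have wo: "Well_order r" using assms(1) card_order_on_well_order_on by blast
  from assms(2) obtain a where a: "a \<in> Field ord_rel" "r =o Restr ord_rel (underS ord_rel a)"
    using ordLess_iff_ordIso_Restr[OF Well_order_ord_rel wo] by blast
  from a(1) obtain x where x: "a = Rep_ordinal x" using Rep_ordinal_cases by metis
  have "Field (Restr ord_rel (underS ord_rel a)) = underS ord_rel a"
    by (rule Field_Restr_ofilter[OF Well_order_ord_rel wo_rel.underS_ofilter])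
       (simp add: wo_rel_def Well_order_ord_rel)
  then have "|Field r| =o |underS ord_rel a|"
    using card_of_cong[OF a(2)] by simp
  then have "r =o |underS ord_rel a|"
    by (rule ordIso_transitive[OF ordIso_symmetric[OF card_of_Field_ordIso[OF assms(1)]]])
  moreover have "|underS ord_rel a| =o |{..<x}|"
    using card_of_image_Rep[of "{..<x}"] by (simp only: x image_Rep_lessThan)
  ultimately have "r =o |{..<x}|" by (rule ordIso_transitive)
  then show ?thesis by (rule that[OF ordIso_symmetric])
qed

lemma uncountable_if_cardSuc:
  assumes "|A| =o cardSuc natLeq"
  shows "uncountable A"
proof
  assume "countable A"
  then obtain f :: "_ \<Rightarrow> nat" where "inj_on f A" unfolding countable_def by blast
  then have "|A| \<le>o |UNIV :: nat set|" by (intro card_of_ordLeq[THEN iffD1]) auto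
  then have "|A| \<le>o natLeq" by (rule ordLeq_ordIso_trans[OF _ card_of_nat])
  then have "cardSuc natLeq \<le>o natLeq"
    by (rule ordIso_ordLeq_trans[OF ordIso_symmetric[OF assms]])
  then show False using not_ordLess_ordLeq[OF cardSuc_greater[OF natLeq_Card_order]] by simp
qed

lemma uncountable_omega1: "uncountable {..<\<Omega>}"
  and countable_below_omega1: "x < \<Omega> \<Longrightarrow> countable {..<x}"
proof -
  have "cardSuc natLeq <o ord_rel"
    by (rule ordLess_transitive[OF cardSuc_greater cardSuc_greater];
        intro cardSuc_Card_order natLeq_Card_order)
  then obtain x :: ordinal where x: "|{..<x}| =o cardSuc natLeq"
    by (rule ex_lessThan_card[OF cardSuc_Card_order[OF natLeq_Card_order]])
  have "uncountable {..<x}" using x by (rule uncountable_if_cardSuc)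
  then show "uncountable {..<\<Omega>}" unfolding omega1_def by (rule LeastI)
  show "x < \<Omega> \<Longrightarrow> countable {..<x}" for x
    unfolding omega1_def using not_less_Least by blast
qed

lemma omega1_lesspoll_omega2: "{..<\<Omega>} \<prec> {..<\<omega>\<^sub>2}"
  and below_omega2_lepoll: "x < \<omega>\<^sub>2 \<Longrightarrow> {..<x} \<lesssim> {..<\<Omega>}"
proof -
  have c1: "cardSuc natLeq <o ord_rel"
    by (rule ordLess_transitive[OF cardSuc_greater cardSuc_greater];
        intro cardSuc_Card_order natLeq_Card_order)
  have c2: "cardSuc (cardSuc natLeq) <o ord_rel"
    by (intro cardSuc_greater cardSuc_Card_order natLeq_Card_order)
  have c12: "cardSuc natLeq <o cardSuc (cardSuc natLeq)"
    by (intro cardSuc_greater cardSuc_Card_order natLeq_Card_order)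
  obtain x :: ordinal where x: "|{..<x}| =o cardSuc natLeq"
    using ex_lessThan_card[OF cardSuc_Card_order[OF natLeq_Card_order] c1] .
  obtain y :: ordinal where y: "|{..<y}| =o cardSuc (cardSuc natLeq)"
    using ex_lessThan_card[OF cardSuc_Card_order[OF cardSuc_Card_order[OF natLeq_Card_order]] c2] .
  have "uncountable {..<x}" using x by (rule uncountable_if_cardSuc)
  then have "\<Omega> \<le> x" unfolding omega1_def by (rule Least_le)
  then have "|{..<\<Omega>}| \<le>o |{..<x}|" by (intro card_of_mono1) auto
  then have "|{..<\<Omega>}| <o |{..<y}|"
    by (rule ordLeq_ordLess_trans[OF _ ordIso_ordLess_trans[OF x
          ordLess_ordIso_trans[OF c12 ordIso_symmetric[OF y]]]])
  then have "{..<\<Omega>} \<prec> {..<y}"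
    unfolding lesspoll_def lepoll_def eqpoll_def card_of_ordLeq card_of_ordIso
    using ordLess_imp_ordLeq not_ordLess_ordIso by blast
  then show "{..<\<Omega>} \<prec> {..<\<omega>\<^sub>2}" unfolding omega2_def by (rule LeastI)
  show "{..<x} \<lesssim> {..<\<Omega>}" if "x < \<omega>\<^sub>2" for x
  proof -
    have "\<not> {..<\<Omega>} \<prec> {..<x}" using that not_less_Least unfolding omega2_def by blast
    then show ?thesis
      unfolding lesspoll_def lepoll_def eqpoll_def card_of_ordLeq card_of_ordIso
      using ordLeq_total[OF card_of_Well_order card_of_Well_order]
        ordIso_symmetric ordIso_imp_ordLeq by blast
  qed
qed

definition is_normal :: "(ordinal \<Rightarrow> ordinal) \<Rightarrow> bool"
  where "is_normal f \<longleftrightarrow>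
    (\<forall>x\<in>{1..<\<Omega>}. f x \<in> {1..<\<Omega>}) \<and>
    strict_mono_on {1..<\<Omega>} f \<and>
    (\<forall>x<\<Omega>. is_limit x \<longrightarrow> f x = (SUP y\<in>{1..<x}. f y))"

definition V :: "(ordinal \<Rightarrow> ordinal) \<Rightarrow> ordinal set"
  where "V f = f ` {1..<\<Omega>}"

text \<open>Functions are only relevant on \<open>{1..<\<Omega>}\<close>, so the derivative is given as a relation, which
  determines \<open>g\<close> on that set.\<close>

definition is_derivative :: "(ordinal \<Rightarrow> ordinal) \<Rightarrow> (ordinal \<Rightarrow> ordinal) \<Rightarrow> bool"
  where "is_derivative g f \<longleftrightarrow> is_normal g \<and> V g = {x\<in>{1..<\<Omega>}. f x = x}"

definition second_kind :: "ordinal \<Rightarrow> bool"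
  where "second_kind \<eta> \<longleftrightarrow> is_limit \<eta> \<and> \<eta> < \<omega>\<^sub>2 \<and> cofinality \<eta> = omega"

definition third_kind :: "ordinal \<Rightarrow> bool"
  where "third_kind \<eta> \<longleftrightarrow> is_limit \<eta> \<and> \<eta> < \<omega>\<^sub>2 \<and> cofinality \<eta> = \<Omega>"

definition increasing_to :: "(ordinal \<Rightarrow> ordinal) \<Rightarrow> ordinal \<Rightarrow> ordinal \<Rightarrow> bool"
  where "increasing_to s \<tau> \<eta> \<longleftrightarrow>
    strict_mono_on {..<\<tau>} s \<and> (SUP x\<in>{..<\<tau>}. s x) = \<eta>"

text \<open>The condition holds vacuously when \<open>\<alpha> = \<beta>\<close>, as happens for \<open>\<eta>\<^sub>x + 1 = \<eta>\<^bsub>x + 1\<^esub>\<close>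
  in a sequence converging to a limit \<open>\<eta>\<close>.\<close>

definition arrow :: "(ordinal \<Rightarrow> ordinal \<Rightarrow> ordinal) \<Rightarrow> ordinal \<Rightarrow> ordinal \<Rightarrow> bool"
  where "arrow \<phi> \<alpha> \<beta> \<longleftrightarrow> (\<forall>\<zeta>. \<alpha> < \<zeta> \<and> \<zeta> \<le> \<beta> \<longrightarrow> V (\<phi> \<zeta>) \<subseteq> V (\<phi> \<alpha>))"

end

theory Submission
  imports Defs
begin

text \<open>
  The ranges of the \<open>\<phi>\<^sub>\<eta>\<close> are closed unbounded subsets of \<open>\<Omega>\<close>, so countably many of them always
  have a common element; by (4) no countable subset of \<open>\<Lambda>\<close> is cofinal. On the other hand, each
  set \<open>{\<eta> < \<Lambda>. \<phi>\<^sub>\<eta>(1) = \<gamma>}\<close> with \<open>\<gamma> < \<Omega>\<close> is bounded in \<open>\<Lambda>\<close> by some \<open>b\<^sub>\<gamma>\<close>, since otherwise \<open>\<gamma>\<close>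
  would lie in the intersection of cofinally many ranges. These \<open>\<Omega>\<close> many bounds are cofinal
  in \<open>\<Lambda>\<close>, so \<open>\<Lambda>\<close> has cofinality \<open>\<Omega>\<close>, and \<open>\<Lambda> < \<omega>\<^sub>2\<close> because \<open>\<omega>\<^sub>2\<close> is regular.
\<close>

section \<open>Countable ordinals and the regularity of \<Omega>\<close>

lemma ordinal_one_le_iff: "1 \<le> x \<longleftrightarrow> x \<noteq> (0::ordinal)"
  by (simp flip: not_less)

lemma omega1_succ_less:
  assumes "x < \<Omega>"
  shows "x + 1 < \<Omega>"
proof (rule ccontr)
  assume "\<not> x + 1 < \<Omega>"
  then have "{..<\<Omega>} \<subseteq> {..<x + 1}" by auto
  also have "\<dots> = insert x {..<x}" by (auto simp: less_plus_one_iff)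
  finally have "{..<\<Omega>} \<subseteq> insert x {..<x}" .
  moreover have "countable (insert x {..<x})"
    using countable_below_omega1[OF assms] by simp
  ultimately show False
    using uncountable_omega1 countable_subset by blast
qed

lemma one_less_omega1: "1 < \<Omega>"
proof -
  have "{..<1::ordinal} = {0}" by auto
  then have "\<Omega> \<noteq> 0" "\<Omega> \<noteq> 1"
    using uncountable_omega1 by (auto simp: lessThan_def)
  then show ?thesis
    using ordinal_one_le_iff[of \<Omega>] by (simp add: order_less_le)
qed

text \<open>Regularity of \<Omega>: if no countable ordinal lay strictly above \<open>A\<close>,
  then \<Omega> would be covered by countably many countable initial segments.\<close>

lemma countable_bounded_omega1:
  assumes "countable A" "A \<subseteq> {..<\<Omega>}"
  obtains u where "u < \<Omega>" "\<And>a. a \<in> A \<Longrightarrow> a < u"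
proof -
  have "\<exists>u<\<Omega>. \<forall>a\<in>A. a < u"
  proof (rule ccontr)
    assume "\<not> (\<exists>u<\<Omega>. \<forall>a\<in>A. a < u)"
    \<comment> \<open>Each \<open>u < \<Omega>\<close> is only known to satisfy
      \<open>u \<le> a\<close> for some \<open>a\<close>, so the segments must include their
      endpoint \<open>a\<close>.\<close>
    then have "{..<\<Omega>} \<subseteq> (\<Union>a\<in>A. {..<a + 1})"
      by (fastforce simp: less_plus_one_iff not_less)
    moreover have "countable (\<Union>a\<in>A. {..<a + 1})"
      using assms by (auto intro!: countable_UN countable_below_omega1 omega1_succ_less)
    ultimately show False
      using uncountable_omega1 countable_subset by blast
  qed
  then show ?thesis using that by blast
qed

section \<open>Ranges of normal functions are closed and unbounded\<close>

lemma is_normal_ge_self: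
  assumes "is_normal f" "1 \<le> x" "x < \<Omega>"
  shows "x \<le> f x"
  using assms(2,3)
proof (induction x rule: less_induct)
  case (less x)
  have fx: "1 \<le> f x" "f x < \<Omega>"
    using assms(1) less.prems unfolding is_normal_def by auto
  show ?case
  proof (rule ccontr)
    assume "\<not> x \<le> f x"
    then have *: "f x < x" by simp
    \<comment> \<open>Monotonicity makes \<open>f x\<close> a smaller counterexample, against the
      induction hypothesis.\<close>
    then have "f (f x) < f x"
      using assms(1) less.prems fx unfolding is_normal_def by (metis atLeastLessThan_iff strict_mono_onD)
    then show False using less.IH[OF * fx] by simp
  qed
qed

lemma V_unbounded:
  assumes "is_normal f" "x < \<Omega>"
  obtains v where "v \<in> V f" "x < v" "v < \<Omega>"
proof (rule that)
  have x: "1 \<le> x + 1" "x + 1 < \<Omega>"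
    using omega1_succ_less[OF assms(2)] less_plus_one[of x]
    by (auto simp: ordinal_one_le_iff simp del: less_plus_one)
  show "f (x + 1) \<in> V f" using x unfolding V_def by auto
  show "x < f (x + 1)"
    using is_normal_ge_self[OF assms(1) x] by (simp add: plus_one_le_iff)
  show "f (x + 1) < \<Omega>" using assms(1) x unfolding is_normal_def by auto
qed

text \<open>Let \<open>x\<close> be the least argument with \<open>p \<le> f x\<close>. At a limit
  \<open>x\<close>, continuity gives \<open>f x \<le> p\<close>, as all earlier values lie below
  \<open>p\<close>. At a successor, a range element strictly above the preceding value and at most
  \<open>p\<close> is taken at an argument at least \<open>x\<close>, which again forces
  \<open>f x \<le> p\<close>.\<close>

lemma V_closed:
  assumes f: "is_normal f" and p: "0 < p" "p < \<Omega>"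
    and lim: "\<And>q. q < p \<Longrightarrow> \<exists>v\<in>V f. q < v \<and> v \<le> p"
  shows "p \<in> V f"
proof -
  have mono: "f x \<le> f y \<longleftrightarrow> x \<le> y" if "x \<in> {1..<\<Omega>}" "y \<in> {1..<\<Omega>}" for x y
    using f that unfolding is_normal_def by (meson strict_mono_on_less_eq)
  define x where "x = (LEAST x. 1 \<le> x \<and> p \<le> f x)"
  have p1: "1 \<le> p" using p(1) by (auto simp: ordinal_one_le_iff)
  have ex: "1 \<le> p \<and> p \<le> f p" using is_normal_ge_self[OF f p1 p(2)] p1 by simp
  have x: "1 \<le> x" "p \<le> f x" using LeastI[of "\<lambda>x. 1 \<le> x \<and> p \<le> f x", OF ex] unfolding x_def by auto
  have "x \<le> p" unfolding x_def using ex by (rule Least_le)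
  then have x\<Omega>: "x < \<Omega>" using p(2) by simp
  have below: "f y < p" if "1 \<le> y" "y < x" for y
    using not_less_Least[OF that(2)[unfolded x_def]] that(1) by auto
  have "f x \<le> p"
  proof (cases "is_limit x")
    case True
    then have "f x = (SUP y\<in>{1..<x}. f y)"
      using f x\<Omega> unfolding is_normal_def by blast
    also have "\<dots> \<le> p"
    proof (rule cSUP_least)
      have "1 < x"
        using limit_succ_less[OF True limit_pos[OF True]] less_plus_one[of 0]
          ordinal_one_le_iff[of "0 + 1"] by (metis order.strict_trans1 less_irrefl)
      then show "{1..<x} \<noteq> {}" by auto
    qed (use below in \<open>auto intro: less_imp_le\<close>)
    finally show ?thesis .
  next
    case False
    then obtain y where y: "x = y + 1"
      using x(1) unfolding is_limit_def by (auto simp: ordinal_one_le_iff)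
    have yx: "y < x" by (simp add: y)
    \<comment> \<open>\<open>q\<close> is the value at the predecessor \<open>y\<close>. If
      \<open>y = 0\<close>, the argument lies outside the domain and nothing is known about
      \<open>f y\<close>; then \<open>x\<close> is the first argument of the domain and
      \<open>q = 0\<close> serves.\<close>
    obtain q where q: "q < p" "\<And>z. z \<in> {1..<\<Omega>} \<Longrightarrow> q < f z \<Longrightarrow> x \<le> z"
    proof (cases "y = 0")
      case True
      have "x \<le> z" if "z \<in> {1..<\<Omega>}" for z
        using that True y yx by (simp add: plus_one_le_iff ordinal_one_le_iff)
          (metis ordinal_zero_le order.strict_iff_order)
      then show ?thesis using that[OF p(1)] by blast
    next
      case False
      then have y1: "1 \<le> y" by (simp add: ordinal_one_le_iff)
      have "x \<le> z" if "z \<in> {1..<\<Omega>}" "f y < f z" for z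
        using mono[of z y] that y1 yx x\<Omega> by (auto simp: y plus_one_le_iff not_le[symmetric])
      then show ?thesis using that[OF below[OF y1 yx]] by blast
    qed
    from lim[OF q(1)] obtain z where z: "z \<in> {1..<\<Omega>}" "q < f z" "f z \<le> p"
      unfolding V_def by auto
    then have "f x \<le> f z" using q(2) mono x(1) x\<Omega> by auto
    then show ?thesis using z(3) by simp
  qed
  then have "f x = p" using x(2) by simp
  then show ?thesis using x(1) x\<Omega> unfolding V_def by auto
qed

text \<open>Interleaving argument: \<open>u x\<close> is chosen so large that every range in the
  family has a point between \<open>x\<close> and \<open>u x\<close>. Iterating \<open>u\<close>
  from 0 through the natural numbers gives a supremum \<open>p\<close> that is a limit of points of
  each range, hence lies in all of them. Regularity of \<Omega> keeps both \<open>u x\<close> and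
  \<open>p\<close> countable.\<close>

lemma countable_Inter_V_nonempty:
  assumes A: "countable A" and normal: "\<And>a. a \<in> A \<Longrightarrow> is_normal (\<phi> a)"
  shows "(\<Inter>a\<in>A. V (\<phi> a)) \<noteq> {}"
proof -
  have "\<exists>u<\<Omega>. x < u \<and> (\<forall>a\<in>A. \<exists>v\<in>V (\<phi> a). x < v \<and> v < u)" if x: "x < \<Omega>" for x
  proof -
    have "\<exists>v. v \<in> V (\<phi> a) \<and> x < v \<and> v < \<Omega>" if "a \<in> A" for a
      using V_unbounded[OF normal[OF that] x] by metis
    then obtain v where v: "\<And>a. a \<in> A \<Longrightarrow> v a \<in> V (\<phi> a) \<and> x < v a \<and> v a < \<Omega>"
      by metis
    \<comment> \<open>Inserting \<open>x\<close> ensures \<open>x < u\<close> even for empty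
      \<open>A\<close>, so that \<open>0 < p\<close> holds later.\<close>
    have "countable (insert x (v ` A))" "insert x (v ` A) \<subseteq> {..<\<Omega>}"
      using A v x by auto
    then obtain u where "u < \<Omega>" "\<And>b. b \<in> insert x (v ` A) \<Longrightarrow> b < u"
      using countable_bounded_omega1 by metis
    then show ?thesis using v by (intro exI[of _ u]) auto
  qed
  then obtain u where u: "\<And>x. x < \<Omega> \<Longrightarrow>
      u x < \<Omega> \<and> x < u x \<and> (\<forall>a\<in>A. \<exists>v\<in>V (\<phi> a). x < v \<and> v < u x)"
    by metis
  define g where "g n = (u ^^ n) 0" for n
  have g\<Omega>: "g n < \<Omega>" for n
  proof (induction n)
    case 0
    show ?case using one_less_omega1 by (simp add: g_def order.strict_trans[of 0 1])
  qed (use u in \<open>simp add: g_def\<close>)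
  have "countable (range g)" "range g \<subseteq> {..<\<Omega>}" using g\<Omega> by auto
  then obtain w where w: "w < \<Omega>" "\<And>n. g n < w"
    using countable_bounded_omega1 by (metis rangeI)
  define p where "p = (SUP n. g n)"
  have bdd: "bdd_above (range g)" using w(2) by (auto intro!: bdd_aboveI[of _ w] less_imp_le)
  have gp: "g n \<le> p" for n unfolding p_def using bdd by (intro cSUP_upper) auto
  have "p \<le> w" unfolding p_def using w(2) by (intro cSUP_least) (auto intro: less_imp_le)
  then have p\<Omega>: "p < \<Omega>" using w(1) by simp
  have "g 0 < g 1" using u[OF g\<Omega>[of 0]] by (simp add: g_def)
  then have "0 < p" using gp[of 1] by (simp add: g_def)
  have "p \<in> V (\<phi> a)" if a: "a \<in> A" for a
  proof (rule V_closed[OF normal[OF a] \<open>0 < p\<close> p\<Omega>])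
    fix q assume "q < p"
    then obtain n where n: "q < g n"
      unfolding p_def using bdd by (auto simp: less_cSUP_iff)
    obtain v where v: "v \<in> V (\<phi> a)" "g n < v" "v < g (Suc n)"
      using u[OF g\<Omega>[of n]] a by (auto simp: g_def)
    then show "\<exists>v\<in>V (\<phi> a). q < v \<and> v \<le> p"
      using n gp[of "Suc n"] by (intro bexI[of _ v]) auto
  qed
  then show ?thesis by blast
qed

section \<open>Cofinal families, increasing sequences and cofinality\<close>

lemma SUP_eq_limit:
  fixes f :: "ordinal \<Rightarrow> ordinal"
  assumes "is_limit \<Lambda>" "\<And>i. i < k \<Longrightarrow> f i < \<Lambda>" "\<And>y. y < \<Lambda> \<Longrightarrow> \<exists>i<k. y \<le> f i"
  shows "(SUP i\<in>{..<k}. f i) = \<Lambda>"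
proof (rule order.antisym)
  show "(SUP i\<in>{..<k}. f i) \<le> \<Lambda>"
    using assms(2) assms(3)[OF limit_pos[OF assms(1)]]
    by (intro cSUP_least) (auto intro: less_imp_le)
  show "\<Lambda> \<le> (SUP i\<in>{..<k}. f i)"
  proof (rule ccontr)
    assume "\<not> \<Lambda> \<le> (SUP i\<in>{..<k}. f i)"
    \<comment> \<open>Cofinality is given only with \<open>\<le>\<close>; passing to the successor,
      still below the limit \<Lambda>, yields a value strictly above the supremum.\<close>
    then have "(SUP i\<in>{..<k}. f i) + 1 < \<Lambda>"
      using limit_succ_less[OF assms(1)] by simp
    then obtain i where i: "i < k" "(SUP i\<in>{..<k}. f i) + 1 \<le> f i"
      using assms(3) by blast
    have "f i \<le> (SUP i\<in>{..<k}. f i)"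
      using i(1) by (intro cSUP_upper bdd_above_image) auto
    then show False using i(2) by (simp add: plus_one_le_iff)
  qed
qed

lemma cofinality_le:
  assumes "\<And>i. i < k \<Longrightarrow> f i < x" "\<And>y. y < x \<Longrightarrow> \<exists>i<k. y \<le> f i"
  shows "cofinality x \<le> k"
  unfolding cofinality_def using assms by (intro Least_le) blast

lemma cofinality_witness:
  obtains f where "\<And>i. i < cofinality x \<Longrightarrow> f i < x"
    "\<And>y. y < x \<Longrightarrow> \<exists>i<cofinality x. y \<le> f i"
proof -
  have "\<exists>k::ordinal. \<exists>f. (\<forall>i<k. f i < x) \<and> (\<forall>y<x. \<exists>i<k. y \<le> f i)"
    \<comment> \<open>The identity on \<open>x\<close> is cofinal in \<open>x\<close>, so the
      \<open>LEAST\<close> defining \<open>cofinality\<close> ranges over a nonempty set.\<close>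
    by (rule exI[of _ x], rule exI[of _ "\<lambda>i. i"]) auto
  then have "\<exists>f. (\<forall>i<cofinality x. f i < x) \<and> (\<forall>y<x. \<exists>i<cofinality x. y \<le> f i)"
    unfolding cofinality_def by (rule LeastI_ex)
  then show ?thesis using that by blast
qed

text \<open>The cofinal family \<open>b\<close> need not be monotone. It is replaced by the
  recursion that picks the least value at least \<open>b x\<close> and strictly above all earlier
  values. Only countably many values precede stage \<open>x\<close>, so \<open>bnd\<close> keeps the
  recursion below \<Lambda>.\<close>

lemma ex_increasing_to_omega1:
  assumes \<Lambda>: "is_limit \<Lambda>"
    and bnd: "\<And>A. countable A \<Longrightarrow> A \<subseteq> {..<\<Lambda>} \<Longrightarrow> \<exists>z<\<Lambda>. \<forall>a\<in>A. a < z"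
    and b: "\<And>i. i < \<Omega> \<Longrightarrow> b i < \<Lambda>" "\<And>y. y < \<Lambda> \<Longrightarrow> \<exists>i<\<Omega>. y \<le> b i"
  shows "\<exists>f. increasing_to f \<Omega> \<Lambda>"
proof -
  define F where "F f x = (LEAST c. b x \<le> c \<and> (\<forall>y<x. f y < c))" for f x
  \<comment> \<open>\<open>F f x\<close> consults \<open>f\<close> only below \<open>x\<close>, so
    well-founded recursion yields a fixed point of \<open>F\<close>.\<close>
  define f where "f = wfrec {(x, y). x < y} F"
  have f_eq: "f x = (LEAST c. b x \<le> c \<and> (\<forall>y<x. f y < c))" for x
  proof -
    have "adm_wf {(x, y). x < y} F"
      unfolding adm_wf_def F_def by auto
    then have "f x = F f x"
      unfolding f_def using wfrec_fixpoint[OF wf] by metis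
    then show ?thesis by (simp add: F_def)
  qed
  have *: "f x < \<Lambda> \<and> b x \<le> f x \<and> (\<forall>y<x. f y < f x)" if "x < \<Omega>" for x
    using that
  proof (induction x rule: less_induct)
    case (less x)
    have "countable (insert (b x) (f ` {..<x}))" "insert (b x) (f ` {..<x}) \<subseteq> {..<\<Lambda>}"
      using countable_below_omega1[OF less.prems] less b(1) by auto
    from bnd[OF this] obtain z where z: "z < \<Lambda>" "b x \<le> z \<and> (\<forall>y<x. f y < z)"
      by (auto intro: less_imp_le)
    have "f x \<le> z" by (subst f_eq, rule Least_le) (rule z(2))
    moreover have "b x \<le> f x \<and> (\<forall>y<x. f y < f x)"
      by (subst (1 3) f_eq, rule LeastI[of "\<lambda>c. b x \<le> c \<and> (\<forall>y<x. f y < c)"]) (rule z(2))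
    ultimately show ?case using z(1) by auto
  qed
  have "strict_mono_on {..<\<Omega>} f"
    using * by (auto intro!: strict_mono_onI)
  moreover have "(SUP x\<in>{..<\<Omega>}. f x) = \<Lambda>"
    using * b(2) by (intro SUP_eq_limit[OF \<Lambda>]) (auto, meson order.trans)
  ultimately show ?thesis unfolding increasing_to_def by blast
qed

text \<open>Otherwise \<open>\<omega>\<^sub>2\<close> would be covered by \<Omega> many initial
  segments, each of size at most that of \<Omega>; such a union again has at most the size of
  \<Omega>.\<close>

lemma omega2_not_omega1_cofinal:
  assumes "\<And>i. i < \<Omega> \<Longrightarrow> b i < \<omega>\<^sub>2"
  shows "\<exists>y<\<omega>\<^sub>2. \<forall>i<\<Omega>. b i \<le> y"
proof (rule ccontr)
  assume "\<not> (\<exists>y<\<omega>\<^sub>2. \<forall>i<\<Omega>. b i \<le> y)"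
  then have "{..<\<omega>\<^sub>2} \<subseteq> (\<Union>i\<in>{..<\<Omega>}. {..<b i})"
    by (fastforce simp: not_le)
  then have "|{..<\<omega>\<^sub>2}| \<le>o |\<Union>i\<in>{..<\<Omega>}. {..<b i}|"
    by (rule card_of_mono1)
  moreover have "|\<Union>i\<in>{..<\<Omega>}. {..<b i}| \<le>o |{..<\<Omega>}|"
  proof (rule card_of_UNION_ordLeq_infinite)
    show "infinite {..<\<Omega>}" using uncountable_omega1 countable_finite by blast
    show "\<forall>i\<in>{..<\<Omega>}. |{..<b i}| \<le>o |{..<\<Omega>}|"
      using below_omega2_lepoll[OF assms] unfolding lepoll_def card_of_ordLeq by blast
  qed (rule ordIso_imp_ordLeq[OF card_of_refl])
  ultimately have "|{..<\<omega>\<^sub>2}| \<le>o |{..<\<Omega>}|" by (rule ordLeq_transitive)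
  then have "{..<\<omega>\<^sub>2} \<lesssim> {..<\<Omega>}" unfolding lepoll_def card_of_ordLeq .
  then show False using omega1_lesspoll_omega2 lesspoll_trans1 lesspoll_def
    by (metis lepoll_antisym)
qed

theorem theorem2:
  fixes \<Lambda> :: ordinal
    and \<phi> :: "ordinal \<Rightarrow> ordinal \<Rightarrow> ordinal"
    and \<tau> :: "ordinal \<Rightarrow> ordinal"
    and s :: "ordinal \<Rightarrow> ordinal \<Rightarrow> ordinal"
  assumes "is_limit \<Lambda>" and "\<Lambda> \<le> \<omega>\<^sub>2"
    and "\<forall>\<eta><\<Lambda>. is_normal (\<phi> \<eta>)"
    and prop1a: "\<forall>x\<in>{1..<\<Omega>}. \<phi> 0 x = omega_pow x"
    and prop1b: "\<forall>\<eta>. \<eta> + 1 < \<Lambda> \<longrightarrow> is_derivative (\<phi> (\<eta> + 1)) (\<phi> \<eta>)"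
    and prop1c: "\<forall>\<eta><\<Lambda>. second_kind \<eta> \<longrightarrow>
      is_limit (\<tau> \<eta>) \<and> \<tau> \<eta> < \<Omega> \<and> increasing_to (s \<eta>) (\<tau> \<eta>) \<eta> \<and>
      V (\<phi> \<eta>) = (\<Inter>x\<in>{..<\<tau> \<eta>}. V (\<phi> (s \<eta> x)))"
    and prop1d: "\<forall>\<eta><\<Lambda>. third_kind \<eta> \<longrightarrow>
      \<tau> \<eta> = \<Omega> \<and> increasing_to (s \<eta>) \<Omega> \<eta> \<and>
      (\<forall>x\<in>{1..<\<Omega>}. \<phi> \<eta> x = \<phi> (s \<eta> x) 1)"
    and prop2a: "\<forall>\<eta><\<Lambda>. is_limit \<eta> \<longrightarrow> (\<forall>x\<in>{1..<\<tau> \<eta>}. is_limit x \<longrightarrow>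
      is_limit (s \<eta> x) \<and> \<tau> (s \<eta> x) = x \<and> (\<forall>y<x. s (s \<eta> x) y = s \<eta> y))"
    and prop2b: "\<forall>\<eta><\<Lambda>. is_limit \<eta> \<longrightarrow> (\<forall>x\<in>{1..<\<tau> \<eta>}.
      arrow \<phi> (s \<eta> x + 1) (s \<eta> (x + 1)))"
    and prop3: "\<forall>\<eta><\<Lambda>. second_kind \<eta> \<and> \<phi> \<eta> 1 = \<tau> \<eta> \<longrightarrow>
      (\<exists>\<eta>'. third_kind \<eta>' \<and> \<eta> < \<eta>' \<and> \<eta>' < \<Lambda> \<and>
        (\<forall>x<\<tau> \<eta>. s \<eta>' x = s \<eta> x) \<and> s \<eta>' (\<tau> \<eta>) = \<eta>)"
    and prop4: "\<forall>\<mu> f. is_limit \<mu> \<and> (\<forall>\<nu><\<mu>. f \<nu> < \<Lambda>) \<and> (SUP \<nu>\<in>{..<\<mu>}. f \<nu>) = \<Lambda> \<longrightarrow>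
      (\<Inter>\<nu>\<in>{..<\<mu>}. V (\<phi> (f \<nu>))) = {}"
  shows "third_kind \<Lambda> \<and> (\<exists>f. increasing_to f \<Omega> \<Lambda>)"
proof -
  \<comment> \<open>Contrapositive of \<open>prop4\<close>. For unbounded \<open>A\<close>, choosing
    an element of \<open>A\<close> at or above each \<open>z < \<Lambda>\<close> gives a sequence of
    length \<Lambda> itself with supremum \<Lambda>.\<close>
  have bounded: "\<exists>z<\<Lambda>. \<forall>a\<in>A. a < z"
    if sub: "A \<subseteq> {..<\<Lambda>}" and ne: "(\<Inter>a\<in>A. V (\<phi> a)) \<noteq> {}" for A
  proof (rule ccontr)
    assume "\<not> (\<exists>z<\<Lambda>. \<forall>a\<in>A. a < z)"
    then have "\<forall>z<\<Lambda>. \<exists>a. a \<in> A \<and> z \<le> a" by (metis not_less)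
    then obtain f where f: "\<And>z. z < \<Lambda> \<Longrightarrow> f z \<in> A \<and> z \<le> f z" by metis
    then have f\<Lambda>: "f z < \<Lambda>" if "z < \<Lambda>" for z using sub that by blast
    have "(SUP \<nu>\<in>{..<\<Lambda>}. f \<nu>) = \<Lambda>"
      using f f\<Lambda> by (intro SUP_eq_limit[OF assms(1)]) auto
    then have "(\<Inter>\<nu>\<in>{..<\<Lambda>}. V (\<phi> (f \<nu>))) = {}"
      using prop4 assms(1) f\<Lambda> by blast
    moreover have "(\<Inter>a\<in>A. V (\<phi> a)) \<subseteq> (\<Inter>\<nu>\<in>{..<\<Lambda>}. V (\<phi> (f \<nu>)))"
      using f by blast
    ultimately show False using ne by blast
  qed
  have countable_bounded: "\<exists>z<\<Lambda>. \<forall>a\<in>A. a < z" if "countable A" "A \<subseteq> {..<\<Lambda>}" for A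
    using that assms(3) by (intro bounded countable_Inter_V_nonempty) auto
  have range1: "\<phi> \<eta> 1 < \<Omega>" if "\<eta> < \<Lambda>" for \<eta>
    using assms(3) that one_less_omega1 unfolding is_normal_def by auto
  have "\<exists>z<\<Lambda>. \<forall>\<eta>\<in>{\<eta>. \<eta> < \<Lambda> \<and> \<phi> \<eta> 1 = \<gamma>}. \<eta> < z" for \<gamma>
  proof (rule bounded)
    \<comment> \<open>The common first value is itself a point of all these ranges.\<close>
    have "\<gamma> \<in> V (\<phi> \<eta>)" if "\<phi> \<eta> 1 = \<gamma>" for \<eta>
      using that one_less_omega1 unfolding V_def by auto
    then show "(\<Inter>\<eta>\<in>{\<eta>. \<eta> < \<Lambda> \<and> \<phi> \<eta> 1 = \<gamma>}. V (\<phi> \<eta>)) \<noteq> {}" by blast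
  qed auto
  then obtain b where b: "\<And>\<gamma>. b \<gamma> < \<Lambda>" "\<And>\<gamma> \<eta>. \<eta> < \<Lambda> \<Longrightarrow> \<phi> \<eta> 1 = \<gamma> \<Longrightarrow> \<eta> < b \<gamma>"
    by (metis (mono_tags, lifting) mem_Collect_eq)
  have b_cofinal: "\<exists>\<gamma><\<Omega>. \<eta> \<le> b \<gamma>" if "\<eta> < \<Lambda>" for \<eta>
    using b(2)[OF that refl] range1[OF that] by (auto intro: less_imp_le)
  have "\<Lambda> < \<omega>\<^sub>2"
  proof (rule ccontr)
    assume "\<not> \<Lambda> < \<omega>\<^sub>2"
    then have eq: "\<Lambda> = \<omega>\<^sub>2" using assms(2) by simp
    obtain y where y: "y < \<Lambda>" "\<forall>i<\<Omega>. b i \<le> y"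
      using omega2_not_omega1_cofinal[of b] b(1) unfolding eq by blast
    \<comment> \<open>The alleged bound \<open>y\<close> is an ordinal below \<Lambda>, hence lies
      strictly below \<open>b\<close> at the countable index \<open>\<phi> y 1\<close>.\<close>
    then show False using b(2)[OF y(1) refl] range1[OF y(1)] by fastforce
  qed
  moreover have "cofinality \<Lambda> = \<Omega>"
  proof (rule order.antisym)
    show "cofinality \<Lambda> \<le> \<Omega>" using b(1) b_cofinal by (rule cofinality_le)
    show "\<Omega> \<le> cofinality \<Lambda>"
    proof (rule ccontr)
      assume "\<not> \<Omega> \<le> cofinality \<Lambda>"
      \<comment> \<open>A countable cofinality would give a countable cofinal set of values, which
        \<open>countable_bounded\<close> places strictly below some \<open>z < \<Lambda>\<close>; no
        value then reaches \<open>z\<close>.\<close>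
      then have "countable {..<cofinality \<Lambda>}" by (simp add: countable_below_omega1)
      moreover obtain f where f: "\<And>i. i < cofinality \<Lambda> \<Longrightarrow> f i < \<Lambda>"
        "\<And>y. y < \<Lambda> \<Longrightarrow> \<exists>i<cofinality \<Lambda>. y \<le> f i"
        using cofinality_witness[of \<Lambda>] by metis
      ultimately obtain z where "z < \<Lambda>" "\<forall>a\<in>f ` {..<cofinality \<Lambda>}. a < z"
        using countable_bounded[of "f ` {..<cofinality \<Lambda>}"] by auto
      then show False using f(2)[of z] by (auto simp: not_le[symmetric])
    qed
  qed
  moreover have "\<exists>f. increasing_to f \<Omega> \<Lambda>"
    using assms(1) countable_bounded b(1) b_cofinal by (rule ex_increasing_to_omega1)
  ultimately show ?thesis using assms(1) unfolding third_kind_def by blast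
qed

end
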